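(* Let $n\ge 1$ and let $\mathcal{S}$ be a semiring. Then the counting games $CG^n_m$ are sound for $\equiv_m$ on $\mathcal{S}$ for all $m\in\mathbb{N}$ (i.e. for all model-defining $\mathcal{S}$-interpretations $\pi_A,\pi_B$ with finite universes, if Duplicator wins $CG^n_m(\pi_A,\pi_B)$ then $\pi_A\equiv_m\pi_B$) if and only if $\mathcal{S}$ is $n$-idempotent.
   Context: A semiring is $\mathcal{S}=(S,+,\cdot,0,1)$ with $0\ne1$, commutative monoids $(S,+,0),(S,\cdot,1)$, distributivity, $0\cdot s=0$, naturally ordered ($s\le t:\Leftrightarrow\exists r\,(s+r=t)$ is a partial order). $\mathcal{S}$ is $n$-idempotent if $\sum_{i\in I}s=\sum_{j\in J}s$ and $\prod_{i\in I}s=\prod_{j\in J}s$ for all $s\in S$ and all finite index sets $I,J$ with $|I|\ge n$, $|J|\ge n$. For a finite relational vocabulary $\tau$ and universe $A$, an $\mathcal{S}$-interpretation is $\pi:\mathrm{Lit}_A(\tau)\to S$ on the literals $R\bar a,\neg R\bar a$; it is model-defining if for each atom exactly one of $\pi(R\bar a),\pi(\neg R\bar a)$ is $0$. Formulae in negation normal form are evaluated with equalities by truth value ($0/1$), literals by $\pi$, $\vee,\exists$ as sums and $\wedge,\forall$ as products over the universe; $\equiv_m$ means equal values for all sentences of quantifier rank $\le m$. In each of the $m$ rounds of $CG^n_m(\pi_A,\bar a,\pi_B,\bar b)$, Spoiler chooses a set $X\subseteq A$ or $X\subseteq B$ with $|X|\le n$, Duplicator answers with a subset $Y$ of the other universe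 with $|Y|=|X|$, then Spoiler picks $y\in Y$ and Duplicator responds with $x\in X$; the pair is appended to the tuples (element of $A$ to the $A$-tuple, element of $B$ to the $B$-tuple). Duplicator wins iff the final map between the tuples is a local isomorphism (same equality pattern and equal values $\pi_A(L(\bar a'))=\pi_B(L(\bar b'))$ for all $\tau$-literals $L$). *)

theory Defs
  imports Main "HOL-Library.Infinite_Typeclass"
begin

definition n_idempotent :: "'s::comm_semiring_1 itself \<Rightarrow> nat \<Rightarrow> bool" where
  "n_idempotent S n \<longleftrightarrow>
     (\<forall>(s::'s) (I::nat set) (J::nat set).
        finite I \<and> finite J \<and> card I \<ge> n \<and> card J \<ge> n \<longrightarrow>
        (\<Sum>i\<in>I. s) = (\<Sum>j\<in>J. s) \<and> (\<Prod>i\<in>I. s) = (\<Prod>j\<in>J. s))"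

text \<open>
  A relational vocabulary is a set \<open>\<tau>\<close> of relation symbols together with an arity function \<open>ar\<close>.
  The terms \<open>'a\<close> of a literal are universe elements when it is an argument of an interpretation,
  variables when it occurs in a formula, and tuple positions in local isomorphisms.
\<close>

datatype ('r, 'a) literal = Pos 'r "'a list" | Neg 'r "'a list"

definition atom_args :: "('r \<Rightarrow> nat) \<Rightarrow> 'a set \<Rightarrow> 'r \<Rightarrow> 'a list set" where
  "atom_args ar A R = {as. length as = ar R \<and> set as \<subseteq> A}"

definition literals :: "'r set \<Rightarrow> ('r \<Rightarrow> nat) \<Rightarrow> 'a set \<Rightarrow> ('r, 'a) literal set" where
  "literals \<tau> ar A = (\<Union>R\<in>\<tau>. Pos R ` atom_args ar A R \<union> Neg R ` atom_args ar A R)"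

text \<open>
  An interpretation with universe \<open>A\<close> is a total function, but only its values on
  \<open>literals \<tau> ar A\<close> are ever used.
\<close>

type_synonym ('r, 'a, 's) interp = "('r, 'a) literal \<Rightarrow> 's"

definition model_defining ::
  "'r set \<Rightarrow> ('r \<Rightarrow> nat) \<Rightarrow> 'a set \<Rightarrow> ('r, 'a, 's::zero) interp \<Rightarrow> bool" where
  "model_defining \<tau> ar A \<pi> \<longleftrightarrow>
     (\<forall>R\<in>\<tau>. \<forall>as\<in>atom_args ar A R. (\<pi> (Pos R as) = 0) \<noteq> (\<pi> (Neg R as) = 0))"

datatype 'r formula =
    Lit "('r, nat) literal"
  | Eq nat nat
  | Neq nat nat
  | Or "'r formula" "'r formula"
  | And "'r formula" "'r formula"
  | Ex nat "'r formula"
  | All nat "'r formula"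

primrec eval ::
  "'a set \<Rightarrow> ('r, 'a, 's::comm_semiring_1) interp \<Rightarrow> (nat \<Rightarrow> 'a) \<Rightarrow> 'r formula \<Rightarrow> 's" where
  "eval A \<pi> \<beta> (Lit L) = \<pi> (map_literal id \<beta> L)"
| "eval A \<pi> \<beta> (Eq x y) = (if \<beta> x = \<beta> y then 1 else 0)"
| "eval A \<pi> \<beta> (Neq x y) = (if \<beta> x \<noteq> \<beta> y then 1 else 0)"
| "eval A \<pi> \<beta> (Or \<phi> \<psi>) = eval A \<pi> \<beta> \<phi> + eval A \<pi> \<beta> \<psi>"
| "eval A \<pi> \<beta> (And \<phi> \<psi>) = eval A \<pi> \<beta> \<phi> * eval A \<pi> \<beta> \<psi>"
| "eval A \<pi> \<beta> (Ex x \<phi>) = (\<Sum>a\<in>A. eval A \<pi> (\<beta>(x := a)) \<phi>)"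
| "eval A \<pi> \<beta> (All x \<phi>) = (\<Prod>a\<in>A. eval A \<pi> (\<beta>(x := a)) \<phi>)"

primrec qrank :: "'r formula \<Rightarrow> nat" where
  "qrank (Lit L) = 0"
| "qrank (Eq x y) = 0"
| "qrank (Neq x y) = 0"
| "qrank (Or \<phi> \<psi>) = max (qrank \<phi>) (qrank \<psi>)"
| "qrank (And \<phi> \<psi>) = max (qrank \<phi>) (qrank \<psi>)"
| "qrank (Ex x \<phi>) = Suc (qrank \<phi>)"
| "qrank (All x \<phi>) = Suc (qrank \<phi>)"

text \<open>\<open>formula_in \<tau> ar V \<phi>\<close>: \<open>\<phi>\<close> is a \<open>\<tau>\<close>-formula whose free variables lie in \<open>V\<close>.\<close>

primrec formula_in :: "'r set \<Rightarrow> ('r \<Rightarrow> nat) \<Rightarrow> nat set \<Rightarrow> 'r formula \<Rightarrow> bool" where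
  "formula_in \<tau> ar V (Lit L) \<longleftrightarrow> L \<in> literals \<tau> ar V"
| "formula_in \<tau> ar V (Eq x y) \<longleftrightarrow> x \<in> V \<and> y \<in> V"
| "formula_in \<tau> ar V (Neq x y) \<longleftrightarrow> x \<in> V \<and> y \<in> V"
| "formula_in \<tau> ar V (Or \<phi> \<psi>) \<longleftrightarrow> formula_in \<tau> ar V \<phi> \<and> formula_in \<tau> ar V \<psi>"
| "formula_in \<tau> ar V (And \<phi> \<psi>) \<longleftrightarrow> formula_in \<tau> ar V \<phi> \<and> formula_in \<tau> ar V \<psi>"
| "formula_in \<tau> ar V (Ex x \<phi>) \<longleftrightarrow> formula_in \<tau> ar (insert x V) \<phi>"
| "formula_in \<tau> ar V (All x \<phi>) \<longleftrightarrow> formula_in \<tau> ar (insert x V) \<phi>"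

abbreviation sentence :: "'r set \<Rightarrow> ('r \<Rightarrow> nat) \<Rightarrow> 'r formula \<Rightarrow> bool" where
  "sentence \<tau> ar \<phi> \<equiv> formula_in \<tau> ar {} \<phi>"

lemma eval_cong:
  assumes "formula_in \<tau> ar V \<phi>" and "\<And>x. x \<in> V \<Longrightarrow> \<beta> x = \<gamma> x"
  shows "eval A \<pi> \<beta> \<phi> = eval A \<pi> \<gamma> \<phi>"
  using assms
proof (induction \<phi> arbitrary: V \<beta> \<gamma>)
  case (Lit L)
  then have "map_literal id \<beta> L = map_literal id \<gamma> L"
    by (auto simp: literals_def atom_args_def subset_iff)
  then show ?case by simp
next
  case (Ex x \<phi>)
  have "eval A \<pi> (\<beta>(x := a)) \<phi> = eval A \<pi> (\<gamma>(x := a)) \<phi>" for a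
    using Ex.prems by (intro Ex.IH[of "insert x V"]) auto
  then show ?case by simp
next
  case (All x \<phi>)
  have "eval A \<pi> (\<beta>(x := a)) \<phi> = eval A \<pi> (\<gamma>(x := a)) \<phi>" for a
    using All.prems by (intro All.IH[of "insert x V"]) auto
  then show ?case by simp
next
  case (Or \<phi> \<psi>)
  have "eval A \<pi> \<beta> \<phi> = eval A \<pi> \<gamma> \<phi>" "eval A \<pi> \<beta> \<psi> = eval A \<pi> \<gamma> \<psi>"
    using Or.prems by (auto intro!: Or.IH[of V])
  then show ?case by simp
next
  case (And \<phi> \<psi>)
  have "eval A \<pi> \<beta> \<phi> = eval A \<pi> \<gamma> \<phi>" "eval A \<pi> \<beta> \<psi> = eval A \<pi> \<gamma> \<psi>"
    using And.prems by (auto intro!: And.IH[of V])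
  then show ?case by simp
qed auto

text \<open>By \<open>eval_cong\<close>, the value of a sentence does not depend on the assignments \<open>\<beta>\<close> and \<open>\<gamma>\<close>.\<close>

definition equiv_rank ::
  "'r set \<Rightarrow> ('r \<Rightarrow> nat) \<Rightarrow> nat \<Rightarrow> 'a set \<Rightarrow> ('r, 'a, 's::comm_semiring_1) interp \<Rightarrow>
   'b set \<Rightarrow> ('r, 'b, 's) interp \<Rightarrow> bool" where
  "equiv_rank \<tau> ar m A \<pi>\<^sub>A B \<pi>\<^sub>B \<longleftrightarrow>
     (\<forall>\<phi>. sentence \<tau> ar \<phi> \<and> qrank \<phi> \<le> m \<longrightarrow>
        (\<forall>\<beta> \<gamma>. eval A \<pi>\<^sub>A \<beta> \<phi> = eval B \<pi>\<^sub>B \<gamma> \<phi>))"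

definition local_iso ::
  "'r set \<Rightarrow> ('r \<Rightarrow> nat) \<Rightarrow> ('r, 'a, 's) interp \<Rightarrow> 'a list \<Rightarrow>
   ('r, 'b, 's) interp \<Rightarrow> 'b list \<Rightarrow> bool" where
  "local_iso \<tau> ar \<pi>\<^sub>A as \<pi>\<^sub>B bs \<longleftrightarrow>
     length as = length bs \<and>
     (\<forall>i < length as. \<forall>j < length as. as ! i = as ! j \<longleftrightarrow> bs ! i = bs ! j) \<and>
     (\<forall>L \<in> literals \<tau> ar {..<length as}.
        \<pi>\<^sub>A (map_literal id (nth as) L) = \<pi>\<^sub>B (map_literal id (nth bs) L))"

text \<open>
  \<open>dup_wins_CG \<tau> ar n m A \<pi>\<^sub>A as B \<pi>\<^sub>B bs\<close>: Duplicator has a winning strategy in the \<open>m\<close>-round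
  counting game from the given position. A Spoiler who chooses the empty set has no second move,
  so that this choice never helps him.
\<close>

primrec dup_wins_CG ::
  "'r set \<Rightarrow> ('r \<Rightarrow> nat) \<Rightarrow> nat \<Rightarrow> nat \<Rightarrow>
   'a set \<Rightarrow> ('r, 'a, 's) interp \<Rightarrow> 'a list \<Rightarrow>
   'b set \<Rightarrow> ('r, 'b, 's) interp \<Rightarrow> 'b list \<Rightarrow> bool" where
  "dup_wins_CG \<tau> ar n 0 A \<pi>\<^sub>A as B \<pi>\<^sub>B bs \<longleftrightarrow> local_iso \<tau> ar \<pi>\<^sub>A as \<pi>\<^sub>B bs"
| "dup_wins_CG \<tau> ar n (Suc m) A \<pi>\<^sub>A as B \<pi>\<^sub>B bs \<longleftrightarrow>
     (\<forall>X. X \<subseteq> A \<and> finite X \<and> card X \<le> n \<longrightarrow>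
        (\<exists>Y. Y \<subseteq> B \<and> finite Y \<and> card Y = card X \<and>
           (\<forall>y\<in>Y. \<exists>x\<in>X. dup_wins_CG \<tau> ar n m A \<pi>\<^sub>A (as @ [x]) B \<pi>\<^sub>B (bs @ [y])))) \<and>
     (\<forall>X. X \<subseteq> B \<and> finite X \<and> card X \<le> n \<longrightarrow>
        (\<exists>Y. Y \<subseteq> A \<and> finite Y \<and> card Y = card X \<and>
           (\<forall>y\<in>Y. \<exists>x\<in>X. dup_wins_CG \<tau> ar n m A \<pi>\<^sub>A (as @ [y]) B \<pi>\<^sub>B (bs @ [x]))))"

text \<open>
  Soundness of \<open>CG\<^sup>n\<^sub>m\<close> for equivalence up to quantifier rank \<open>m\<close>, over all finite vocabularies
  with symbols from \<open>'r\<close> and all finite universes drawn from \<open>'u\<close>. To have universes of every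
  finite size, \<open>'u\<close> must be infinite.
\<close>

definition CG_sound ::
  "'s::comm_semiring_1 itself \<Rightarrow> 'r itself \<Rightarrow> 'u itself \<Rightarrow> nat \<Rightarrow> nat \<Rightarrow> bool" where
  "CG_sound S R U n m \<longleftrightarrow>
     (\<forall>(\<tau>::'r set) (ar :: 'r \<Rightarrow> nat) (A::'u set) (B::'u set)
        (\<pi>\<^sub>A :: ('r, 'u, 's) interp) (\<pi>\<^sub>B :: ('r, 'u, 's) interp).
        finite \<tau> \<and> finite A \<and> A \<noteq> {} \<and> finite B \<and> B \<noteq> {} \<and>
        model_defining \<tau> ar A \<pi>\<^sub>A \<and> model_defining \<tau> ar B \<pi>\<^sub>B \<and>
        dup_wins_CG \<tau> ar n m A \<pi>\<^sub>A [] B \<pi>\<^sub>B [] \<longrightarrow>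
        equiv_rank \<tau> ar m A \<pi>\<^sub>A B \<pi>\<^sub>B)"

end

theory Submission
  imports Defs
begin

text \<open>
  Suppose the semiring is \<open>n\<close>-idempotent. If Duplicator wins, then for a quantified formula every
  value \<open>s\<close> of the matrix is attained equally often in both universes or at least \<open>n\<close> times in
  each: Spoiler plays up to \<open>n\<close> elements with value \<open>s\<close>, and every element of Duplicator's answer
  must have value \<open>s\<close>, too. Hence the sums and the products agree. Conversely, a sum or product
  of copies of \<open>s \<noteq> 0\<close> is the value of \<open>\<exists>x. R x\<close> or \<open>\<forall>x. R x\<close> in an interpretation where
  \<open>R\<close> is constantly \<open>s\<close>, and Duplicator wins the one-round game on two such
  interpretations as soon as both universes have at least \<open>n\<close> elements.
\<close>

section \<open>Idempotence and sums grouped by value\<close>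

lemma n_idempotent_iff:
  "n_idempotent TYPE('s::comm_semiring_1) n \<longleftrightarrow>
     (\<forall>(s::'s) k l. n \<le> k \<and> n \<le> l \<longrightarrow> of_nat k * s = of_nat l * s \<and> s ^ k = s ^ l)"
    (is "?L \<longleftrightarrow> ?R")
proof
  assume L: ?L
  show ?R
  proof (intro allI impI)
    fix s :: 's and k l assume "n \<le> k \<and> n \<le> l"
    then show "of_nat k * s = of_nat l * s \<and> s ^ k = s ^ l"
      using L[unfolded n_idempotent_def, rule_format, of "{..<k}" "{..<l}" s] by simp
  qed
next
  assume ?R
  then show ?L by (simp add: n_idempotent_def)
qed

lemma n_idempotent_imp_sum_prod_eq:
  fixes f :: "'a \<Rightarrow> 's::comm_semiring_1" and g :: "'b \<Rightarrow> 's"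
  assumes idem: "n_idempotent TYPE('s) n"
    and fin: "finite A" "finite B"
    and counts: "\<And>s. card {a\<in>A. f a = s} = card {b\<in>B. g b = s} \<or>
                  n \<le> card {a\<in>A. f a = s} \<and> n \<le> card {b\<in>B. g b = s}"
  shows "sum f A = sum g B" and "prod f A = prod g B"
proof -
  \<comment> \<open>A common index set for both groupings: a value attained on one side only has an
    empty class on the other.\<close>
  define T where "T = f ` A \<union> g ` B"
  have T: "finite T" "f ` A \<subseteq> T" "g ` B \<subseteq> T"
    using fin by (auto simp: T_def)
  have eq: "of_nat (card {a\<in>A. f a = s}) * s = of_nat (card {b\<in>B. g b = s}) * s"
           "s ^ card {a\<in>A. f a = s} = s ^ card {b\<in>B. g b = s}" for s
    using counts[of s] idem[unfolded n_idempotent_iff, rule_format] by auto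
  have "sum f A = (\<Sum>s\<in>T. of_nat (card {a\<in>A. f a = s}) * s)"
    using sum.group[OF fin(1) T(1,2), of f] by simp
  also have "\<dots> = (\<Sum>s\<in>T. of_nat (card {b\<in>B. g b = s}) * s)"
    by (simp only: eq)
  also have "\<dots> = sum g B"
    using sum.group[OF fin(2) T(1,3), of g] by simp
  finally show "sum f A = sum g B" .
  have "prod f A = (\<Prod>s\<in>T. s ^ card {a\<in>A. f a = s})"
    using prod.group[OF fin(1) T(1,2), of f] by simp
  also have "\<dots> = (\<Prod>s\<in>T. s ^ card {b\<in>B. g b = s})"
    by (simp only: eq)
  also have "\<dots> = prod g B"
    using prod.group[OF fin(2) T(1,3), of g] by simp
  finally show "prod f A = prod g B" .
qed

section \<open>Literals and local isomorphisms\<close>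

lemma literals_simps [simp]:
  "Pos R as \<in> literals \<tau> ar A \<longleftrightarrow> R \<in> \<tau> \<and> length as = ar R \<and> set as \<subseteq> A"
  "Neg R as \<in> literals \<tau> ar A \<longleftrightarrow> R \<in> \<tau> \<and> length as = ar R \<and> set as \<subseteq> A"
  by (auto simp: literals_def atom_args_def)

lemma map_literal_in_literals:
  assumes "L \<in> literals \<tau> ar V" "f ` V \<subseteq> W"
  shows "map_literal id f L \<in> literals \<tau> ar W"
  using assms by (cases L) auto

lemma map_literal_cong_literals:
  assumes "L \<in> literals \<tau> ar V" "\<And>x. x \<in> V \<Longrightarrow> f x = g x"
  shows "map_literal id f L = map_literal id g L"
  using assms by (cases L) auto

lemma local_iso_butlast:
  assumes "local_iso \<tau> ar \<pi>\<^sub>A (as @ [a]) \<pi>\<^sub>B (bs @ [b])"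
  shows "local_iso \<tau> ar \<pi>\<^sub>A as \<pi>\<^sub>B bs"
proof -
  have len: "length as = length bs"
    using assms by (simp add: local_iso_def)
  have "as ! i = as ! j \<longleftrightarrow> bs ! i = bs ! j" if "i < length as" "j < length as" for i j
  proof -
    have "(as @ [a]) ! i = (as @ [a]) ! j \<longleftrightarrow> (bs @ [b]) ! i = (bs @ [b]) ! j"
      using assms that by (simp add: local_iso_def)
    then show ?thesis using that len by (simp add: nth_append)
  qed
  moreover have "\<pi>\<^sub>A (map_literal id (nth as) L) = \<pi>\<^sub>B (map_literal id (nth bs) L)"
    if L: "L \<in> literals \<tau> ar {..<length as}" for L
  proof -
    have "L \<in> literals \<tau> ar {..<length (as @ [a])}"
      using map_literal_in_literals[OF L, of id "{..<length (as @ [a])}"]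
      by (simp add: literal.map_id)
    then have "\<pi>\<^sub>A (map_literal id (nth (as @ [a])) L) = \<pi>\<^sub>B (map_literal id (nth (bs @ [b])) L)"
      using assms by (simp add: local_iso_def)
    moreover have "map_literal id (nth (as @ [a])) L = map_literal id (nth as) L"
      by (rule map_literal_cong_literals[OF L]) (simp add: nth_append)
    moreover have "map_literal id (nth (bs @ [b])) L = map_literal id (nth bs) L"
      by (rule map_literal_cong_literals[OF L]) (simp add: nth_append len)
    ultimately show ?thesis by simp
  qed
  ultimately show ?thesis using len by (simp add: local_iso_def)
qed

text \<open>Since \<open>n \<ge> 1\<close> and \<open>A\<close> is nonempty, Spoiler can always play
  a singleton. The remaining rounds thus lead to a final local isomorphism, which restricts to the
  present tuples.\<close>

lemma dup_wins_CG_imp_local_iso: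
  assumes "n \<ge> 1" "A \<noteq> {}" "dup_wins_CG \<tau> ar n m A \<pi>\<^sub>A as B \<pi>\<^sub>B bs"
  shows "local_iso \<tau> ar \<pi>\<^sub>A as \<pi>\<^sub>B bs"
  using assms(3)
proof (induction m arbitrary: as bs)
  case 0
  then show ?case by simp
next
  case (Suc m)
  obtain a where "a \<in> A" using \<open>A \<noteq> {}\<close> by blast
  then have "{a} \<subseteq> A \<and> finite {a} \<and> card {a} \<le> n" using \<open>n \<ge> 1\<close> by simp
  then obtain Y where Y: "card Y = card {a}"
      "\<forall>y\<in>Y. \<exists>x\<in>{a}. dup_wins_CG \<tau> ar n m A \<pi>\<^sub>A (as @ [x]) B \<pi>\<^sub>B (bs @ [y])"
    using Suc.prems[unfolded dup_wins_CG.simps, THEN conjunct1, rule_format, of "{a}"] by blast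
  then obtain y where "y \<in> Y" by fastforce
  with Y have "dup_wins_CG \<tau> ar n m A \<pi>\<^sub>A (as @ [a]) B \<pi>\<^sub>B (bs @ [y])" by blast
  then show ?case by (blast intro: local_iso_butlast Suc.IH)
qed

section \<open>From winning positions to equal values\<close>

lemma dup_wins_CG_Suc_imp_counts:
  assumes win: "dup_wins_CG \<tau> ar n (Suc m) A \<pi>\<^sub>A as B \<pi>\<^sub>B bs"
    and fin: "finite A" "finite B"
    and eq: "\<And>a b. \<lbrakk>a \<in> A; b \<in> B; dup_wins_CG \<tau> ar n m A \<pi>\<^sub>A (as @ [a]) B \<pi>\<^sub>B (bs @ [b])\<rbrakk>
              \<Longrightarrow> f a = g b"
  shows "card {a\<in>A. f a = s} = card {b\<in>B. g b = s} \<or>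
         n \<le> card {a\<in>A. f a = s} \<and> n \<le> card {b\<in>B. g b = s}"
proof -
  let ?F = "{a\<in>A. f a = s}" and ?G = "{b\<in>B. g b = s}"
  have zig: "min n (card ?F) \<le> card ?G"
  proof -
    \<comment> \<open>The largest legal Spoiler move inside the value class.\<close>
    obtain X where X: "X \<subseteq> ?F" "card X = min n (card ?F)"
      by (meson min.cobounded2 obtain_subset_with_card_n)
    then have "X \<subseteq> A \<and> finite X \<and> card X \<le> n" using fin by (auto dest: finite_subset)
    then obtain Y where "Y \<subseteq> B" "card Y = card X"
        "\<forall>y\<in>Y. \<exists>x\<in>X. dup_wins_CG \<tau> ar n m A \<pi>\<^sub>A (as @ [x]) B \<pi>\<^sub>B (bs @ [y])"
      using win[unfolded dup_wins_CG.simps, THEN conjunct1, rule_format, of X] by blast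
    \<comment> \<open>Each \<open>y\<close> in \<open>Y\<close> has a winning reply \<open>x\<close>
      in \<open>X\<close>, and \<open>f x = s\<close> forces \<open>g y = s\<close>.\<close>
    moreover from this X eq have "Y \<subseteq> ?G" by fastforce
    ultimately show ?thesis using X fin card_mono[of ?G Y] by simp
  qed
  have zag: "min n (card ?G) \<le> card ?F"
  proof -
    obtain X where X: "X \<subseteq> ?G" "card X = min n (card ?G)"
      by (meson min.cobounded2 obtain_subset_with_card_n)
    then have "X \<subseteq> B \<and> finite X \<and> card X \<le> n" using fin by (auto dest: finite_subset)
    then obtain Y where "Y \<subseteq> A" "card Y = card X"
        "\<forall>y\<in>Y. \<exists>x\<in>X. dup_wins_CG \<tau> ar n m A \<pi>\<^sub>A (as @ [y]) B \<pi>\<^sub>B (bs @ [x])"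
      using win[unfolded dup_wins_CG.simps, THEN conjunct2, rule_format, of X] by blast
    moreover from this X eq have "Y \<subseteq> ?F" by fastforce
    ultimately show ?thesis using X fin card_mono[of ?F Y] by simp
  qed
  \<comment> \<open>If either count is below \<open>n\<close>, the two inequalities make the counts
    equal.\<close>
  from zig zag show ?thesis by linarith
qed

text \<open>Induction on the formula. The map \<open>p\<close> sends each variable of
  \<open>V\<close> to the tuple position holding its value, because tuples grow with every round
  while a variable may be bound again.\<close>

lemma dup_wins_CG_imp_eval_eq:
  fixes \<pi>\<^sub>A :: "('r, 'a, 's::comm_semiring_1) interp" and \<pi>\<^sub>B :: "('r, 'b, 's) interp"
  assumes idem: "n_idempotent TYPE('s) n" and n: "n \<ge> 1"
    and fin: "finite A" "finite B" and ne: "A \<noteq> {}"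
    and "dup_wins_CG \<tau> ar n m A \<pi>\<^sub>A as B \<pi>\<^sub>B bs"
    and "formula_in \<tau> ar V \<phi>" "qrank \<phi> \<le> m"
    and "\<And>x. x \<in> V \<Longrightarrow> p x < length as \<and> \<beta> x = as ! p x \<and> \<gamma> x = bs ! p x"
  shows "eval A \<pi>\<^sub>A \<beta> \<phi> = eval B \<pi>\<^sub>B \<gamma> \<phi>"
  using assms(6-)
proof (induction \<phi> arbitrary: V m as bs p \<beta> \<gamma>)
  case (Lit L)
  have "local_iso \<tau> ar \<pi>\<^sub>A as \<pi>\<^sub>B bs"
    by (rule dup_wins_CG_imp_local_iso[OF n ne Lit.prems(1)])
  moreover have L: "L \<in> literals \<tau> ar V" using Lit.prems by simp
  \<comment> \<open>Local isomorphisms speak about positions, so the literal over variables is first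
    renamed along \<open>p\<close>.\<close>
  then have "map_literal id p L \<in> literals \<tau> ar {..<length as}"
    using Lit.prems(4) by (intro map_literal_in_literals) auto
  ultimately have "\<pi>\<^sub>A (map_literal id (nth as) (map_literal id p L)) =
                   \<pi>\<^sub>B (map_literal id (nth bs) (map_literal id p L))"
    by (simp add: local_iso_def)
  moreover have "map_literal id (nth as) (map_literal id p L) = map_literal id \<beta> L"
    using map_literal_cong_literals[OF L, of "nth as \<circ> p" \<beta>] Lit.prems(4)
    by (simp add: literal.map_comp)
  moreover have "map_literal id (nth bs) (map_literal id p L) = map_literal id \<gamma> L"
    using map_literal_cong_literals[OF L, of "nth bs \<circ> p" \<gamma>] Lit.prems(4)
    by (simp add: literal.map_comp)
  ultimately show ?case by simp
next
  case (Eq x y)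
  with dup_wins_CG_imp_local_iso[OF n ne Eq.prems(1)] show ?case
    by (simp add: local_iso_def)
next
  case (Neq x y)
  with dup_wins_CG_imp_local_iso[OF n ne Neq.prems(1)] show ?case
    by (simp add: local_iso_def)
next
  case (Or \<phi> \<psi>)
  have "eval A \<pi>\<^sub>A \<beta> \<phi> = eval B \<pi>\<^sub>B \<gamma> \<phi>"
    using Or.prems by (intro Or.IH(1)[where V=V and p=p]) auto
  moreover have "eval A \<pi>\<^sub>A \<beta> \<psi> = eval B \<pi>\<^sub>B \<gamma> \<psi>"
    using Or.prems by (intro Or.IH(2)[where V=V and p=p]) auto
  ultimately show ?case by simp
next
  case (And \<phi> \<psi>)
  have "eval A \<pi>\<^sub>A \<beta> \<phi> = eval B \<pi>\<^sub>B \<gamma> \<phi>"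
    using And.prems by (intro And.IH(1)[where V=V and p=p]) auto
  moreover have "eval A \<pi>\<^sub>A \<beta> \<psi> = eval B \<pi>\<^sub>B \<gamma> \<psi>"
    using And.prems by (intro And.IH(2)[where V=V and p=p]) auto
  ultimately show ?case by simp
next
  case (Ex x \<phi>)
  obtain k where k: "m = Suc k" "qrank \<phi> \<le> k" using Ex.prems(3) by (cases m) auto
  have len: "length as = length bs"
    using dup_wins_CG_imp_local_iso[OF n ne Ex.prems(1)] by (simp add: local_iso_def)
  \<comment> \<open>The bound variable is sent to the appended position \<open>length as\<close>,
    overriding any earlier position of \<open>x\<close>. This equation is what the counting lemma
    requires of the two matrix values.\<close>
  have "eval A \<pi>\<^sub>A (\<beta>(x := a)) \<phi> = eval B \<pi>\<^sub>B (\<gamma>(x := b)) \<phi>"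
    if "dup_wins_CG \<tau> ar n k A \<pi>\<^sub>A (as @ [a]) B \<pi>\<^sub>B (bs @ [b])" for a b
    using that k(2) Ex.prems(2,4) len
    by (intro Ex.IH[where V="insert x V" and p="p(x := length as)"])
      (auto simp: nth_append less_Suc_eq)
  from n_idempotent_imp_sum_prod_eq(1)
    [OF idem fin dup_wins_CG_Suc_imp_counts[OF Ex.prems(1)[unfolded k(1)] fin this]]
  show ?case by simp
next
  case (All x \<phi>)
  obtain k where k: "m = Suc k" "qrank \<phi> \<le> k" using All.prems(3) by (cases m) auto
  have len: "length as = length bs"
    using dup_wins_CG_imp_local_iso[OF n ne All.prems(1)] by (simp add: local_iso_def)
  have "eval A \<pi>\<^sub>A (\<beta>(x := a)) \<phi> = eval B \<pi>\<^sub>B (\<gamma>(x := b)) \<phi>"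
    if "dup_wins_CG \<tau> ar n k A \<pi>\<^sub>A (as @ [a]) B \<pi>\<^sub>B (bs @ [b])" for a b
    using that k(2) All.prems(2,4) len
    by (intro All.IH[where V="insert x V" and p="p(x := length as)"])
      (auto simp: nth_append less_Suc_eq)
  from n_idempotent_imp_sum_prod_eq(2)
    [OF idem fin dup_wins_CG_Suc_imp_counts[OF All.prems(1)[unfolded k(1)] fin this]]
  show ?case by simp
qed

lemma n_idempotent_imp_CG_sound:
  assumes "n \<ge> 1" "n_idempotent TYPE('s::comm_semiring_1) n"
  shows "CG_sound TYPE('s) TYPE('r) TYPE('u) n m"
  unfolding CG_sound_def equiv_rank_def
  \<comment> \<open>For a sentence the condition on \<open>p\<close> is vacuous.\<close>
  using dup_wins_CG_imp_eval_eq[OF assms(2,1), where V="{}"] by blast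

section \<open>Necessity of idempotence via constant interpretations\<close>

definition const_interp :: "'s::zero \<Rightarrow> ('r, 'a, 's) interp" where
  "const_interp s L = (case L of Pos R as \<Rightarrow> s | Neg R as \<Rightarrow> 0)"

lemma const_interp_simps [simp]:
  "const_interp s (Pos R as) = s" "const_interp s (Neg R as) = 0"
  by (simp_all add: const_interp_def)

text \<open>Any two single elements are locally isomorphic here, so Duplicator only needs enough
  elements to match the size of Spoiler's set.\<close>

lemma dup_wins_CG_const_interp:
  fixes A B :: "'b set"
  assumes "finite A" "finite B" "n \<le> card A" "n \<le> card B"
  shows "dup_wins_CG \<tau> ar n 1 A (const_interp s) [] B (const_interp s) []"
proof -
  have iso: "local_iso \<tau> ar (const_interp s) [a] (const_interp s) [b]" for a b
    by (auto simp: local_iso_def literals_def)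
  \<comment> \<open>The last conjunct provides a reply in \<open>X\<close> once Spoiler has picked
    from \<open>Y\<close>.\<close>
  have answer: "\<exists>Y\<subseteq>C. finite Y \<and> card Y = card X \<and> (Y \<noteq> {} \<longrightarrow> X \<noteq> {})"
    if "finite X" "card X \<le> n" "finite C" "n \<le> card C" for X C :: "'b set"
  proof -
    have "card X \<le> card C" using that by linarith
    then obtain Y where "Y \<subseteq> C" "card Y = card X" "finite Y"
      by (rule obtain_subset_with_card_n)
    then show ?thesis by (intro exI[of _ Y]) auto
  qed
  show ?thesis
    using answer[OF _ _ assms(2,4)] answer[OF _ _ assms(1,3)] iso by fastforce
qed

lemma CG_sound_imp_n_idempotent:
  assumes n: "n \<ge> 1"
    and sound: "CG_sound TYPE('s::comm_semiring_1) TYPE('r) TYPE('u::infinite) n 1"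
  shows "n_idempotent TYPE('s) n"
  unfolding n_idempotent_iff
proof (intro allI impI)
  fix s :: 's and k l assume kl: "n \<le> k \<and> n \<le> l"
  show "of_nat k * s = of_nat l * s \<and> s ^ k = s ^ l"
  proof (cases "s = 0")
    \<comment> \<open>The constant interpretation with value 0 is not model-defining. Here
      \<open>n \<ge> 1\<close> makes both exponents positive, so both powers are 0.\<close>
    case True
    then show ?thesis using kl n by (simp add: power_0_left)
  next
    case False
    obtain A B :: "'u set" where A: "finite A" "card A = k" and B: "finite B" "card B = l"
      by (metis infinite_UNIV infinite_arbitrarily_large)
    \<comment> \<open>An arbitrary symbol, made unary below.\<close>
    define R :: 'r where "R = undefined"
    define ar :: "'r \<Rightarrow> nat" where "ar = (\<lambda>_. 1)"
    let ?\<pi> = "const_interp s :: ('r, 'u, 's) interp"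
    have "A \<noteq> {}" "B \<noteq> {}" using A B kl n by auto
    moreover have "model_defining {R} ar C ?\<pi>" for C
      using False by (simp add: model_defining_def)
    moreover have "dup_wins_CG {R} ar n 1 A ?\<pi> [] B ?\<pi> []"
      using A B kl by (intro dup_wins_CG_const_interp) auto
    ultimately have equiv: "equiv_rank {R} ar 1 A ?\<pi> B ?\<pi>"
      using A(1) B(1) by (intro sound[unfolded CG_sound_def, rule_format] conjI) simp_all
    define \<phi> where "\<phi> = Lit (Pos R [0::nat])"
    have "formula_in {R} ar {0} \<phi>" "qrank \<phi> = 0"
      by (auto simp: \<phi>_def ar_def literals_def atom_args_def)
    with equiv have "eval A ?\<pi> \<beta> (Ex 0 \<phi>) = eval B ?\<pi> \<beta> (Ex 0 \<phi>)"
        "eval A ?\<pi> \<beta> (All 0 \<phi>) = eval B ?\<pi> \<beta> (All 0 \<phi>)" for \<beta>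
      by (simp_all add: equiv_rank_def del: eval.simps)
    \<comment> \<open>The matrix has value \<open>s\<close> at every element, so the two sentences
      evaluate to \<open>of_nat k * s\<close> and \<open>s ^ k\<close> over \<open>A\<close>, and
      likewise with \<open>l\<close> over \<open>B\<close>.\<close>
    then show ?thesis using A B by (simp add: \<phi>_def)
  qed
qed

theorem theorem3p6:
  fixes n :: nat
  assumes "n \<ge> 1"
  shows "(\<forall>m. CG_sound TYPE('s::{comm_semiring_1, canonically_ordered_monoid_add})
                TYPE('r) TYPE('u::infinite) n m)
           \<longleftrightarrow> n_idempotent TYPE('s) n"
  \<comment> \<open>Soundness is applied at \<open>m = 1\<close> to obtain idempotence.\<close>
  using assms CG_sound_imp_n_idempotent n_idempotent_imp_CG_sound by blast

end
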